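(* Let $G$ be a graph on $V=\{1,\dots,n\}$ drawn from the stochastic block model with clusters $V_1,\dots,V_K$ of sizes $n_1,\dots,n_K$, intra-cluster edge probabilities $p_a$ and inter-cluster edge probabilities $q_{ab}$, satisfying $\max_{a\ne b}q_{ab}=o(\min_a p_a)$ and $n_ap_a=\omega_n$ for all $a$, for some sequence $\omega_n\to\infty$. Let $L=D-A$ be its unnormalized Laplacian with eigenvalues $0=\lambda_0\le\lambda_1\le\dots\le\lambda_{n-1}$ and corresponding orthonormal eigenvectors $u_0,\dots,u_{n-1}$, and write $L=L^{\mathrm{block}}+E$, where $L^{\mathrm{block}}$ is the block diagonal part encoding all intra-cluster edges and $E$ captures the inter-cluster edges. Let $f\in PW_\omega(L)$ for some $\omega\in(\lambda_{K-1},\lambda_K)$, so that $f=\sum_{k=0}^{K-1}\hat f_k u_k$. Let $S\subset V$ be a coreset of size $T$ obtained from the GGCS algorithm (described in the context), whose per-cluster counts $m_a=|S\cap V_a|$ satisfy $m_a/T=n_a/n+\epsilon_a$ with $|\epsilon_a|\le\epsilon$ for all $a\in\{1,\dots,K\}$. Let $\Delta=\lambda_K-\lambda_{K-1}$ denote the spectral gap of $L$, and let $$\hat\mu_S=\frac1T\sum_{i\in S}f(i),\qquad \mu=\frac1n\sum_{i\in V}f(i).$$ Then $$|\hat\mu_S-\mu|\le\sqrt{K}\,\|f\|_2\left(\epsilon\sqrt{2K}+\frac{4\|E\|_2}{\Delta\cdot\sqrt{T}}\right).$$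
   Context: Stochastic block model: the node set $V=\{1,\dots,n\}$ is partitioned into $K$ disjoint clusters $V_1,\dots,V_K$ of sizes $n_1,\dots,n_K$ with $\sum_a n_a=n$. Edges of the undirected, unweighted simple graph are drawn independently, with probability $p_a$ between two distinct nodes of $V_a$, and probability $q_{ab}$ between a node of $V_a$ and a node of $V_b$, $a\ne b$. Parameters may depend on $n$; $o(\cdot)$ is as $n\to\infty$. $A$ is the adjacency matrix, $D$ the diagonal degree matrix, $L=D-A$. $L^{\mathrm{block}}$ is the Laplacian of the graph obtained by deleting all inter-cluster edges (perfect cluster separation; block diagonal with respect to the clusters), and $E=L-L^{\mathrm{block}}$ contains the inter-cluster edge contributions. $\|E\|_2$ is the spectral norm and $\|f\|_2$ the Euclidean norm. A graph signal is a vector $f\in\mathbb{R}^n$; its graph Fourier coefficients are $\hat f_k=u_k^\top f$. The Paley-Wiener space is $PW_\omega(L)=\{f\in\mathbb{R}^n:\hat f_k=0\text{ whenever }\lambda_k>\omega\}$. GGCS algorithm (Greedy Graph Coreset Selection): start with residual $\mathbf{b}=\mathbf{0}\in\mathbb{R}^n$ and $\mathcal{X}=\emptyset$. For each of $T$ iterations: draw a small candidate set $\mathcal{C}_t\subset\{1,\dots,n\}$ uniformly at random; among candidates not already selected choose $i^*$ minimizing $|L_{:,j}^\top\mathbf{b}|$, $j\in\mathcal{C}_t$, ties broken uniformly at random; add $i^*$ to $\mathcal{X}$ and replace $\mathbf{b}$ by $\mathbf{b}-L_{:,i^*}$ (where $L_{:,i}$ is the $i$-th column of $L$). The output coreset $S$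 is the final $\mathcal{X}$, a set of $T$ distinct nodes. *)

theory Defs
  imports
    "HOL-Probability.Probability"
    "HOL-Library.Landau_Symbols"
    "Jordan_Normal_Form.Char_Poly"
begin

(* Both HOL-Analysis and Jordan_Normal_Form use the infix symbols for inner product and
   component access; here they always mean the operations on Matrix.vec. *)
no_notation inner (infixl "\<bullet>" 70)
no_notation Finite_Cartesian_Product.vec_nth (infixl "$" 90)

section \<open>Stochastic block model\<close>

text \<open>The nodes are \<open>0, \<dots>, n - 1\<close> and the clusters are numbered \<open>0, \<dots>, K - 1\<close>. The ordered
  partition into clusters is given by a labelling \<open>c\<close> of the nodes. A simple undirected graph is
  represented by its edge set, consisting of two-element sets of nodes.\<close>

definition cluster :: "nat \<Rightarrow> (nat \<Rightarrow> nat) \<Rightarrow> nat \<Rightarrow> nat set" where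
  "cluster n c a = {i. i < n \<and> c i = a}"

text \<open>The equation \<open>c ` {..<n} = {..<K}\<close> includes that all clusters are nonempty. Since edges are
  undirected, \<open>q\<close> has to be symmetric.\<close>

definition sbm_params ::
  "nat \<Rightarrow> nat \<Rightarrow> (nat \<Rightarrow> nat) \<Rightarrow> (nat \<Rightarrow> real) \<Rightarrow> (nat \<Rightarrow> nat \<Rightarrow> real) \<Rightarrow> bool" where
  "sbm_params n K c p q \<longleftrightarrow>
     1 \<le> K \<and> c ` {..<n} = {..<K} \<and>
     (\<forall>a<K. 0 \<le> p a \<and> p a \<le> 1) \<and>
     (\<forall>a<K. \<forall>b<K. a \<noteq> b \<longrightarrow> 0 \<le> q a b \<and> q a b \<le> 1 \<and> q a b = q b a)"

definition edge_prob ::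
  "(nat \<Rightarrow> nat) \<Rightarrow> (nat \<Rightarrow> real) \<Rightarrow> (nat \<Rightarrow> nat \<Rightarrow> real) \<Rightarrow> nat \<Rightarrow> nat \<Rightarrow> real" where
  "edge_prob c p q i j = (if c i = c j then p (c i) else q (c i) (c j))"

text \<open>One independent Bernoulli variable for every unordered pair of distinct nodes, represented
  by the pair \<open>(i, j)\<close> with \<open>i < j\<close>.\<close>

definition sbm ::
  "nat \<Rightarrow> (nat \<Rightarrow> nat) \<Rightarrow> (nat \<Rightarrow> real) \<Rightarrow> (nat \<Rightarrow> nat \<Rightarrow> real) \<Rightarrow> nat set set pmf" where
  "sbm n c p q =
     map_pmf (\<lambda>X. {{i, j} | i j. i < j \<and> j < n \<and> X (i, j)})
       (Pi_pmf {(i, j). i < j \<and> j < n} False (\<lambda>(i, j). bernoulli_pmf (edge_prob c p q i j)))"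

section \<open>Laplacian\<close>

definition adj_mat :: "nat \<Rightarrow> nat set set \<Rightarrow> real mat" where
  "adj_mat n G = mat n n (\<lambda>(i, j). if {i, j} \<in> G then 1 else 0)"

definition deg_mat :: "nat \<Rightarrow> nat set set \<Rightarrow> real mat" where
  "deg_mat n G = mat n n (\<lambda>(i, j). if i = j then real (card {e \<in> G. i \<in> e}) else 0)"

definition laplacian :: "nat \<Rightarrow> nat set set \<Rightarrow> real mat" where
  "laplacian n G = deg_mat n G - adj_mat n G"

definition intra_edges :: "(nat \<Rightarrow> nat) \<Rightarrow> nat set set \<Rightarrow> nat set set" where
  "intra_edges c G = {e \<in> G. \<forall>i\<in>e. \<forall>j\<in>e. c i = c j}"

definition laplacian_block :: "nat \<Rightarrow> (nat \<Rightarrow> nat) \<Rightarrow> nat set set \<Rightarrow> real mat" where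
  "laplacian_block n c G = laplacian n (intra_edges c G)"

definition inter_part :: "nat \<Rightarrow> (nat \<Rightarrow> nat) \<Rightarrow> nat set set \<Rightarrow> real mat" where
  "inter_part n c G = laplacian n G - laplacian_block n c G"

section \<open>Norms and spectral notions\<close>

definition l2_norm :: "real vec \<Rightarrow> real" where
  "l2_norm f = L2_set (\<lambda>i. f $ i) {..<dim_vec f}"

text \<open>Operator norm with respect to the Euclidean norm.\<close>

definition spectral_norm :: "real mat \<Rightarrow> real" where
  "spectral_norm M = (SUP x\<in>{x \<in> carrier_vec (dim_col M). l2_norm x \<le> 1}. l2_norm (M *\<^sub>v x))"

text \<open>\<open>u 0, \<dots>, u (n - 1)\<close> is an orthonormal eigenbasis of \<open>M\<close> whose eigenvalues
  \<open>lam 0, \<dots>, lam (n - 1)\<close> are in increasing order.\<close>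

definition sorted_eigenbasis ::
  "nat \<Rightarrow> real mat \<Rightarrow> (nat \<Rightarrow> real) \<Rightarrow> (nat \<Rightarrow> real vec) \<Rightarrow> bool" where
  "sorted_eigenbasis n M lam u \<longleftrightarrow>
     (\<forall>k<n. eigenvector M (u k) (lam k)) \<and>
     (\<forall>j<n. \<forall>k<n. u j \<bullet> u k = (if j = k then 1 else 0)) \<and>
     (\<forall>j k. j \<le> k \<and> k < n \<longrightarrow> lam j \<le> lam k)"

definition fourier_coeff :: "(nat \<Rightarrow> real vec) \<Rightarrow> real vec \<Rightarrow> nat \<Rightarrow> real" where
  "fourier_coeff u f k = u k \<bullet> f"

definition paley_wiener ::
  "nat \<Rightarrow> (nat \<Rightarrow> real) \<Rightarrow> (nat \<Rightarrow> real vec) \<Rightarrow> real \<Rightarrow> real vec set" where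
  "paley_wiener n lam u w = {f \<in> carrier_vec n. \<forall>k<n. lam k > w \<longrightarrow> fourier_coeff u f k = 0}"

section \<open>Greedy graph coreset selection\<close>

text \<open>The state is the pair of the current residual and the set of nodes selected so far. The size
  \<open>s t\<close> of the candidate set drawn in iteration \<open>t\<close> is a parameter of the algorithm. If all drawn
  candidates have already been selected, the iteration selects nothing; so the output has \<open>T\<close>
  elements if and only if this did not happen.\<close>

definition best_candidates :: "real mat \<Rightarrow> real vec \<Rightarrow> nat set \<Rightarrow> nat set" where
  "best_candidates L b C = {i \<in> C. \<forall>j\<in>C. \<bar>col L i \<bullet> b\<bar> \<le> \<bar>col L j \<bullet> b\<bar>}"

definition ggcs_step ::
  "nat \<Rightarrow> real mat \<Rightarrow> nat \<Rightarrow> real vec \<times> nat set \<Rightarrow> (real vec \<times> nat set) pmf" where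
  "ggcs_step n L m = (\<lambda>(b, X).
     bind_pmf (pmf_of_set {C. C \<subseteq> {..<n} \<and> card C = m}) (\<lambda>C.
       if C \<subseteq> X then return_pmf (b, X)
       else map_pmf (\<lambda>i. (b - col L i, insert i X)) (pmf_of_set (best_candidates L b (C - X)))))"

primrec ggcs_state ::
  "nat \<Rightarrow> real mat \<Rightarrow> (nat \<Rightarrow> nat) \<Rightarrow> nat \<Rightarrow> (real vec \<times> nat set) pmf" where
  "ggcs_state n L s 0 = return_pmf (0\<^sub>v n, {})"
| "ggcs_state n L s (Suc t) = bind_pmf (ggcs_state n L s t) (ggcs_step n L (s t))"

definition ggcs :: "nat \<Rightarrow> real mat \<Rightarrow> (nat \<Rightarrow> nat) \<Rightarrow> nat \<Rightarrow> nat set pmf" where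
  "ggcs n L s T = map_pmf snd (ggcs_state n L s T)"

end

theory Submission
  imports Defs
begin

text \<open>Split \<open>f\<close> into its cluster averages and a remainder \<open>r\<close>. The averages contribute
  \<open>\<Sum>a. eps a * g a\<close>, where \<open>g a\<close> is the mean of \<open>f\<close> over cluster \<open>a\<close>, and the remainder
  contributes at most \<open>\<parallel>r\<parallel> / sqrt T\<close> by Cauchy-Schwarz. For the size of \<open>r\<close> let \<open>w a\<close> be the
  normalised indicator of cluster \<open>a\<close>. Since the block Laplacian annihilates \<open>w a\<close>, we have
  \<open>lam k * (u k \<bullet> w a) = u k \<bullet> E (w a)\<close>, so the part of \<open>w a\<close> orthogonal to \<open>u 0, \<dots>, u (K - 1)\<close>
  has norm at most \<open>\<parallel>E\<parallel> / lam K \<le> \<parallel>E\<parallel> / \<Delta>\<close>. As there are as many clusters as low eigenvectors,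
  the Frobenius norms of the two complementary projections agree, which turns this into
  \<open>\<parallel>r\<parallel> \<le> sqrt K * (\<parallel>E\<parallel> / \<Delta>) * \<parallel>f\<parallel>\<close>.\<close>

section \<open>Orthonormal families\<close>

text \<open>Functions on indices take the place of \<open>vec\<close>, so one notion covers both the
  full eigenbasis (\<open>m = n\<close>) and the normalised cluster indicators
  (\<open>m = K\<close>) without carrier conditions.\<close>

definition orthonormal_family :: "nat \<Rightarrow> nat \<Rightarrow> (nat \<Rightarrow> nat \<Rightarrow> real) \<Rightarrow> bool" where
  "orthonormal_family n m w \<longleftrightarrow>
     (\<forall>a<m. \<forall>b<m. (\<Sum>i<n. w a i * w b i) = (if a = b then 1 else 0))"

text \<open>A one-sided inverse of a square matrix is two-sided: orthonormal rows force orthonormal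
  columns.\<close>

lemma orthonormal_family_columns:
  assumes "orthonormal_family n n U" "i < n" "j < n"
  shows "(\<Sum>k<n. U k i * U k j) = (if i = j then 1 else 0)"
proof -
  let ?A = "mat n n (\<lambda>(k, i). U k i)"
  let ?B = "mat n n (\<lambda>(i, k). U k i)"
  have "?A * ?B = 1\<^sub>m n"
    using assms(1)
    by (intro eq_matI) (auto simp: scalar_prod_def orthonormal_family_def atLeast0LessThan)
  then have "?B * ?A = 1\<^sub>m n"
    by (rule mat_mult_left_right_inverse[rotated 2]) auto
  then have "(?B * ?A) $$ (i, j) = (1\<^sub>m n :: real mat) $$ (i, j)"
    by simp
  then show ?thesis
    using assms by (simp add: scalar_prod_def atLeast0LessThan)
qed

text \<open>After swapping the sums, orthonormality of the columns leaves only the term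
  \<open>j = i\<close>.\<close>

lemma orthonormal_basis_expansion:
  assumes "orthonormal_family n n U" "i < n"
  shows "x i = (\<Sum>k<n. (\<Sum>j<n. U k j * x j) * U k i)"
proof -
  have "(\<Sum>k<n. (\<Sum>j<n. U k j * x j) * U k i) = (\<Sum>j<n. (\<Sum>k<n. U k j * U k i) * x j)"
    by (simp add: sum_distrib_left sum_distrib_right mult_ac) (rule sum.swap)
  also have "\<dots> = (\<Sum>j<n. (if j = i then 1 else 0) * x j)"
    using orthonormal_family_columns[OF assms(1)] assms(2) by (intro sum.cong) auto
  also have "\<dots> = x i"
    using assms(2) by (simp add: if_distrib[of "\<lambda>t. t * _"] cong: if_cong)
  finally show ?thesis ..
qed

lemma orthonormal_basis_parseval:
  assumes "orthonormal_family n n U"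
  shows "(\<Sum>k<n. (\<Sum>j<n. U k j * x j)\<^sup>2) = (\<Sum>i<n. (x i)\<^sup>2)"
proof -
  \<comment> \<open>Only one of the two factors \<open>x i\<close> is expanded in the basis; the
    other one then rebuilds the coefficient.\<close>
  have "(\<Sum>i<n. (x i)\<^sup>2) = (\<Sum>i<n. x i * (\<Sum>k<n. (\<Sum>j<n. U k j * x j) * U k i))"
    using orthonormal_basis_expansion[OF assms, of _ x]
    by (intro sum.cong) (auto simp: power2_eq_square)
  also have "\<dots> = (\<Sum>k<n. \<Sum>i<n. x i * ((\<Sum>j<n. U k j * x j) * U k i))"
    unfolding sum_distrib_left[of "x _"] by (rule sum.swap)
  also have "\<dots> = (\<Sum>k<n. (\<Sum>j<n. U k j * x j)\<^sup>2)"
    by (intro sum.cong) (auto simp: power2_eq_square sum_distrib_left mult_ac)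
  finally show ?thesis ..
qed

text \<open>Pythagoras for the orthogonal projection onto the span of \<open>w\<close>: the cross
  term and the squared norm of the projection both equal the sum of squared coefficients, and they
  enter with factors -2 and 1. Nonnegativity of the left side gives Bessel's inequality.\<close>

lemma orthonormal_family_residual:
  assumes "orthonormal_family n m w"
  shows "(\<Sum>i<n. (x i - (\<Sum>a<m. (\<Sum>j<n. w a j * x j) * w a i))\<^sup>2)
    = (\<Sum>i<n. (x i)\<^sup>2) - (\<Sum>a<m. (\<Sum>j<n. w a j * x j)\<^sup>2)"
proof -
  define h where "h a = (\<Sum>j<n. w a j * x j)" for a
  have cross: "(\<Sum>i<n. x i * (\<Sum>a<m. h a * w a i)) = (\<Sum>a<m. (h a)\<^sup>2)"
  proof -
    have "(\<Sum>i<n. x i * (\<Sum>a<m. h a * w a i)) = (\<Sum>a<m. h a * (\<Sum>i<n. w a i * x i))"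
      by (simp add: sum_distrib_left mult_ac) (rule sum.swap)
    then show ?thesis by (simp add: h_def power2_eq_square)
  qed
  have square: "(\<Sum>i<n. (\<Sum>a<m. h a * w a i)\<^sup>2) = (\<Sum>a<m. (h a)\<^sup>2)"
  proof -
    have "(\<Sum>i<n. (\<Sum>a<m. h a * w a i)\<^sup>2)
        = (\<Sum>i<n. \<Sum>a<m. \<Sum>b<m. h a * h b * (w a i * w b i))"
      by (simp add: power2_eq_square sum_product mult_ac)
    also have "\<dots> = (\<Sum>a<m. \<Sum>i<n. \<Sum>b<m. h a * h b * (w a i * w b i))"
      by (rule sum.swap)
    also have "\<dots> = (\<Sum>a<m. \<Sum>b<m. h a * h b * (\<Sum>i<n. w a i * w b i))"
      unfolding sum_distrib_left by (intro sum.cong refl sum.swap)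
    also have "\<dots> = (\<Sum>a<m. \<Sum>b<m. h a * h b * (if a = b then 1 else 0))"
      using assms by (intro sum.cong) (auto simp: orthonormal_family_def)
    also have "\<dots> = (\<Sum>a<m. (h a)\<^sup>2)"
      by (simp add: power2_eq_square if_distrib[of "\<lambda>t. _ * t"] cong: if_cong)
    finally show ?thesis .
  qed
  have "(\<Sum>i<n. (x i - (\<Sum>a<m. h a * w a i))\<^sup>2)
      = (\<Sum>i<n. (x i)\<^sup>2) - 2 * (\<Sum>i<n. x i * (\<Sum>a<m. h a * w a i))
        + (\<Sum>i<n. (\<Sum>a<m. h a * w a i)\<^sup>2)"
    by (simp add: power2_diff sum.distrib sum_subtractf sum_distrib_left mult.assoc)
  then show ?thesis
    unfolding cross square by (simp add: h_def)
qed

text \<open>Let \<open>P\<close> and \<open>Q\<close> be the projections onto the spans of \<open>w a\<close>, \<open>a < K\<close>, and \<open>U k\<close>, \<open>k < K\<close>. Both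
  squared Frobenius norms \<open>\<parallel>(1 - P) Q\<parallel>\<^sup>2\<close> and \<open>\<parallel>(1 - Q) P\<parallel>\<^sup>2\<close> equal
  \<open>K - (\<Sum>k<K. \<Sum>a<K. (U k \<bullet> w a)\<^sup>2)\<close>.\<close>

lemma bandlimited_residual_bound:
  assumes U: "orthonormal_family n n U" and w: "orthonormal_family n K w" and "K \<le> n"
    and x: "\<And>k. K \<le> k \<Longrightarrow> k < n \<Longrightarrow> (\<Sum>j<n. U k j * x j) = 0"
  shows "(\<Sum>i<n. (x i - (\<Sum>a<K. (\<Sum>j<n. w a j * x j) * w a i))\<^sup>2)
    \<le> (\<Sum>i<n. (x i)\<^sup>2) * (\<Sum>a<K. \<Sum>k=K..<n. (\<Sum>i<n. U k i * w a i)\<^sup>2)"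
proof -
  define h where "h k = (\<Sum>j<n. U k j * x j)" for k
  define M where "M k a = (\<Sum>i<n. U k i * w a i)" for k a
  define R where "R k i = U k i - (\<Sum>a<K. (\<Sum>j<n. w a j * U k j) * w a i)" for k i
  have split: "{..<n} = {..<K} \<union> {K..<n}" using \<open>K \<le> n\<close> by auto
  have expand: "x i = (\<Sum>k<K. h k * U k i)" if "i < n" for i
  proof -
    have "x i = (\<Sum>k<n. h k * U k i)"
      unfolding h_def by (rule orthonormal_basis_expansion[OF U that])
    also have "\<dots> = (\<Sum>k<K. h k * U k i)"
      using x \<open>K \<le> n\<close> by (intro sum.mono_neutral_right) (auto simp: h_def)
    finally show ?thesis .
  qed
  have coeff: "(\<Sum>j<n. w a j * x j) = (\<Sum>k<K. h k * (\<Sum>j<n. w a j * U k j))" for a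
  proof -
    have "(\<Sum>j<n. w a j * x j) = (\<Sum>j<n. w a j * (\<Sum>k<K. h k * U k j))"
      using expand by (intro sum.cong) auto
    also have "\<dots> = (\<Sum>k<K. h k * (\<Sum>j<n. w a j * U k j))"
      by (simp add: sum_distrib_left mult_ac) (rule sum.swap)
    finally show ?thesis .
  qed
  \<comment> \<open>Taking residuals is linear, so the expansion of \<open>x\<close> in the low
    vectors \<open>U k\<close> carries over to their residuals \<open>R k\<close>.\<close>
  have residual: "x i - (\<Sum>a<K. (\<Sum>j<n. w a j * x j) * w a i) = (\<Sum>k<K. h k * R k i)"
    if "i < n" for i
  proof -
    have "(\<Sum>a<K. (\<Sum>j<n. w a j * x j) * w a i)
        = (\<Sum>k<K. h k * (\<Sum>a<K. (\<Sum>j<n. w a j * U k j) * w a i))"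
      unfolding coeff
      by (simp add: sum_distrib_left sum_distrib_right mult.assoc) (rule sum.swap)
    then show ?thesis
      using expand[OF that] by (simp add: R_def right_diff_distrib sum_subtractf)
  qed
  have R_norm: "(\<Sum>i<n. (R k i)\<^sup>2) = 1 - (\<Sum>a<K. (M k a)\<^sup>2)" if "k < K" for k
  proof -
    have "(\<Sum>i<n. (U k i)\<^sup>2) = 1"
      using U that \<open>K \<le> n\<close> by (simp add: orthonormal_family_def power2_eq_square)
    then show ?thesis
      using orthonormal_family_residual[OF w, of "U k"] by (simp add: R_def M_def mult.commute)
  qed
  have M_norm: "1 - (\<Sum>k<K. (M k a)\<^sup>2) = (\<Sum>k=K..<n. (M k a)\<^sup>2)" if "a < K" for a
  proof -
    have "(\<Sum>k<n. (M k a)\<^sup>2) = 1"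
      using w that orthonormal_basis_parseval[OF U, of "w a"]
      by (simp add: M_def orthonormal_family_def power2_eq_square)
    moreover have "(\<Sum>k<n. (M k a)\<^sup>2) = (\<Sum>k<K. (M k a)\<^sup>2) + (\<Sum>k=K..<n. (M k a)\<^sup>2)"
      unfolding split by (rule sum.union_disjoint) auto
    ultimately show ?thesis by simp
  qed
  have "(\<Sum>k<K. \<Sum>i<n. (R k i)\<^sup>2) = (\<Sum>a<K. 1 - (\<Sum>k<K. (M k a)\<^sup>2))"
    by (simp add: R_norm sum_subtractf) (rule sum.swap)
  then have frobenius: "(\<Sum>k<K. \<Sum>i<n. (R k i)\<^sup>2) = (\<Sum>a<K. \<Sum>k=K..<n. (M k a)\<^sup>2)"
    by (simp add: M_norm)
  have h_norm: "(\<Sum>k<K. (h k)\<^sup>2) \<le> (\<Sum>i<n. (x i)\<^sup>2)"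
  proof -
    have "(\<Sum>k<K. (h k)\<^sup>2) \<le> (\<Sum>k<n. (h k)\<^sup>2)"
      using \<open>K \<le> n\<close> by (intro sum_mono2) auto
    then show ?thesis
      unfolding h_def using orthonormal_basis_parseval[OF U, of x] by simp
  qed
  have "(\<Sum>i<n. (x i - (\<Sum>a<K. (\<Sum>j<n. w a j * x j) * w a i))\<^sup>2)
      = (\<Sum>i<n. (\<Sum>k<K. h k * R k i)\<^sup>2)"
    using residual by (intro sum.cong) auto
  \<comment> \<open>Cauchy-Schwarz over \<open>k\<close> at each fixed \<open>i\<close>: the
    operator norm of the family \<open>R\<close> is bounded by its Frobenius norm.\<close>
  also have "\<dots> \<le> (\<Sum>i<n. (\<Sum>k<K. (h k)\<^sup>2) * (\<Sum>k<K. (R k i)\<^sup>2))"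
    by (intro sum_mono Cauchy_Schwarz_ineq_sum)
  also have "\<dots> = (\<Sum>k<K. (h k)\<^sup>2) * (\<Sum>k<K. \<Sum>i<n. (R k i)\<^sup>2)"
    unfolding sum_distrib_left[symmetric] by (subst sum.swap) (rule refl)
  also have "\<dots> \<le> (\<Sum>i<n. (x i)\<^sup>2) * (\<Sum>k<K. \<Sum>i<n. (R k i)\<^sup>2)"
    by (intro mult_right_mono h_norm sum_nonneg) auto
  finally show ?thesis
    unfolding frobenius by (simp add: M_def)
qed

section \<open>Norms\<close>

lemma l2_norm_power2: "(l2_norm x)\<^sup>2 = (\<Sum>i<dim_vec x. (x $ i)\<^sup>2)"
  by (simp add: l2_norm_def L2_set_def sum_nonneg)

lemma l2_norm_nonneg: "0 \<le> l2_norm x"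
  by (simp add: l2_norm_def)

text \<open>The supremum over the reals is an upper bound only once the image of the unit ball is
  known to be bounded. The sum of all absolute entries serves as a crude bound.\<close>

lemma l2_norm_mult_vec_le_spectral_norm:
  assumes "x \<in> carrier_vec (dim_col M)" "l2_norm x \<le> 1"
  shows "l2_norm (M *\<^sub>v x) \<le> spectral_norm M"
  unfolding spectral_norm_def
proof (rule cSUP_upper)
  have "l2_norm (M *\<^sub>v y) \<le> (\<Sum>i<dim_row M. \<Sum>j<dim_col M. \<bar>M $$ (i, j)\<bar>)"
    if y: "y \<in> carrier_vec (dim_col M)" "l2_norm y \<le> 1" for y
  proof -
    have entry: "\<bar>y $ j\<bar> \<le> 1" if "j < dim_col M" for j
    proof -
      have "\<bar>y $ j\<bar> \<le> l2_norm y"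
        using that y(1) member_le_L2_set[of "{..<dim_vec y}" j "\<lambda>j. \<bar>y $ j\<bar>"]
        by (auto simp: l2_norm_def L2_set_def)
      then show ?thesis using y(2) by simp
    qed
    have "l2_norm (M *\<^sub>v y) \<le> (\<Sum>i<dim_row M. \<bar>(M *\<^sub>v y) $ i\<bar>)"
      unfolding l2_norm_def by (rule order_trans[OF L2_set_le_sum_abs]) simp
    also have "\<dots> \<le> (\<Sum>i<dim_row M. \<Sum>j<dim_col M. \<bar>M $$ (i, j)\<bar>)"
    proof (rule sum_mono)
      fix i assume "i \<in> {..<dim_row M}"
      then have "\<bar>(M *\<^sub>v y) $ i\<bar> = \<bar>\<Sum>j<dim_col M. M $$ (i, j) * y $ j\<bar>"
        using y(1) by (simp add: scalar_prod_def atLeast0LessThan)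
      also have "\<dots> \<le> (\<Sum>j<dim_col M. \<bar>M $$ (i, j)\<bar> * \<bar>y $ j\<bar>)"
        by (rule order_trans[OF sum_abs]) (simp add: abs_mult)
      also have "\<dots> \<le> (\<Sum>j<dim_col M. \<bar>M $$ (i, j)\<bar>)"
        using entry by (intro sum_mono mult_left_le) auto
      finally show "\<bar>(M *\<^sub>v y) $ i\<bar> \<le> (\<Sum>j<dim_col M. \<bar>M $$ (i, j)\<bar>)" .
    qed
    finally show ?thesis .
  qed
  then show "bdd_above ((\<lambda>x. l2_norm (M *\<^sub>v x)) ` {x \<in> carrier_vec (dim_col M). l2_norm x \<le> 1})"
    by (intro bdd_aboveI2) auto
qed (use assms in simp)

section \<open>Laplacians of simple graphs\<close>

text \<open>Every graph in the support of \<open>sbm\<close> is of this kind, so the deterministic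
  part of the argument can refer to this property instead of the random model.\<close>

definition simple_edges :: "nat \<Rightarrow> nat set set \<Rightarrow> bool" where
  "simple_edges n G \<longleftrightarrow> G \<subseteq> {{i, j} | i j. i < j \<and> j < n}"

lemma simple_edges_intra_edges: "simple_edges n G \<Longrightarrow> simple_edges n (intra_edges c G)"
  by (auto simp: simple_edges_def intra_edges_def)

lemma set_pmf_sbm: "G \<in> set_pmf (sbm n c p q) \<Longrightarrow> simple_edges n G"
  by (auto simp: sbm_def simple_edges_def)

lemma laplacian_carrier [simp]: "laplacian n G \<in> carrier_mat n n"
  by (auto simp: laplacian_def deg_mat_def adj_mat_def intro!: minus_carrier_mat)

lemma laplacian_symmetric:
  assumes "i < n" "j < n"
  shows "laplacian n G $$ (i, j) = laplacian n G $$ (j, i)"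
  using assms by (auto simp: laplacian_def deg_mat_def adj_mat_def insert_commute)

text \<open>Edges at \<open>i\<close> correspond to neighbours \<open>j\<close> through
  \<open>j\<close> to \<open>{i, j}\<close>, since every edge has exactly two endpoints, both below
  \<open>n\<close>.\<close>

lemma degree_eq_sum_adj:
  assumes "simple_edges n G" "i < n"
  shows "real (card {e \<in> G. i \<in> e}) = (\<Sum>j<n. if {i, j} \<in> G then 1 else 0)"
proof -
  have edge: "\<exists>j<n. j \<noteq> i \<and> e = {i, j}" if "e \<in> G" "i \<in> e" for e
  proof -
    from that(1) assms(1) obtain k l where "e = {k, l}" "k < l" "l < n"
      by (auto simp: simple_edges_def)
    with that(2) have "l < n \<and> l \<noteq> i \<and> e = {i, l} \<or> k < n \<and> k \<noteq> i \<and> e = {i, k}" by auto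
    then show ?thesis by blast
  qed
  have "bij_betw (\<lambda>j. {i, j}) {j. j < n \<and> {i, j} \<in> G} {e \<in> G. i \<in> e}"
    unfolding bij_betw_def
  proof
    show "inj_on (\<lambda>j. {i, j}) {j. j < n \<and> {i, j} \<in> G}"
      by (auto simp: inj_on_def doubleton_eq_iff)
    show "(\<lambda>j. {i, j}) ` {j. j < n \<and> {i, j} \<in> G} = {e \<in> G. i \<in> e}"
      using edge by blast
  qed
  then have "card {e \<in> G. i \<in> e} = card {j. j < n \<and> {i, j} \<in> G}"
    by (simp add: bij_betw_same_card)
  moreover have "{j. j < n \<and> {i, j} \<in> G} = {..<n} \<inter> {j. {i, j} \<in> G}" by auto
  ultimately show ?thesis by (simp add: sum.If_cases)
qed

text \<open>The difference form shows at once which vectors are annihilated and turns the quadratic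
  form into a sum of squares.\<close>

lemma laplacian_mult_vec:
  assumes "simple_edges n G" "x \<in> carrier_vec n" "i < n"
  shows "(laplacian n G *\<^sub>v x) $ i = (\<Sum>j<n. (if {i, j} \<in> G then 1 else 0) * (x $ i - x $ j))"
proof -
  have "(laplacian n G *\<^sub>v x) $ i
      = (\<Sum>j<n. (if i = j then real (card {e \<in> G. i \<in> e}) else 0) * x $ j
                - (if {i, j} \<in> G then 1 else 0) * x $ j)"
    using assms(2,3)
    by (simp add: laplacian_def deg_mat_def adj_mat_def scalar_prod_def atLeast0LessThan
        left_diff_distrib)
  also have "\<dots> = real (card {e \<in> G. i \<in> e}) * x $ i
      - (\<Sum>j<n. (if {i, j} \<in> G then 1 else 0) * x $ j)"
    using assms(3)
    by (simp add: sum_subtractf if_distrib[of "\<lambda>t. t * _"] cong: if_cong)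
  finally show ?thesis
    unfolding degree_eq_sum_adj[OF assms(1,3)]
    by (simp add: sum_distrib_right right_diff_distrib sum_subtractf)
qed

text \<open>Exchanging \<open>i\<close> and \<open>j\<close> and adding both versions gives twice
  the form as the sum of \<open>A i j\<close> times the squared difference of \<open>x\<close> at
  \<open>i\<close> and \<open>j\<close>.\<close>

lemma laplacian_quadratic_form_nonneg:
  assumes "simple_edges n G" "x \<in> carrier_vec n"
  shows "0 \<le> x \<bullet> (laplacian n G *\<^sub>v x)"
proof -
  define A :: "nat \<Rightarrow> nat \<Rightarrow> real" where "A i j = (if {i, j} \<in> G then 1 else 0)" for i j
  have sym: "A i j = A j i" for i j by (simp add: A_def insert_commute)
  have dim: "dim_vec (laplacian n G *\<^sub>v x) = n"
    by (simp add: laplacian_def deg_mat_def adj_mat_def)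
  have Q: "x \<bullet> (laplacian n G *\<^sub>v x) = (\<Sum>i<n. \<Sum>j<n. A i j * (x $ i * (x $ i - x $ j)))"
    unfolding scalar_prod_def dim atLeast0LessThan
    using laplacian_mult_vec[OF assms]
    by (intro sum.cong) (auto simp: sum_distrib_left A_def mult_ac)
  also have "\<dots> = (\<Sum>j<n. \<Sum>i<n. A i j * (x $ i * (x $ i - x $ j)))"
    by (rule sum.swap)
  also have "\<dots> = (\<Sum>i<n. \<Sum>j<n. A i j * (x $ j * (x $ j - x $ i)))"
    by (intro sum.cong refl) (metis sym)
  finally have "2 * (x \<bullet> (laplacian n G *\<^sub>v x))
      = (\<Sum>i<n. \<Sum>j<n. A i j * (x $ i * (x $ i - x $ j)) + A i j * (x $ j * (x $ j - x $ i)))"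
    using Q unfolding sum.distrib by linarith
  also have "\<dots> = (\<Sum>i<n. \<Sum>j<n. A i j * (x $ i - x $ j)\<^sup>2)"
    by (intro sum.cong refl) (simp add: power2_eq_square algebra_simps)
  also have "\<dots> \<ge> 0" by (intro sum_nonneg) (simp add: A_def)
  finally show ?thesis by simp
qed

text \<open>Every remaining edge joins two nodes of one cluster, where the difference of the values
  of \<open>x\<close> is zero.\<close>

lemma laplacian_block_cluster_constant:
  assumes "simple_edges n G" "x \<in> carrier_vec n"
    and "\<And>i j. i < n \<Longrightarrow> j < n \<Longrightarrow> c i = c j \<Longrightarrow> x $ i = x $ j"
  shows "laplacian_block n c G *\<^sub>v x = 0\<^sub>v n"
proof (rule eq_vecI)
  fix i assume "i < dim_vec (0\<^sub>v n :: real vec)"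
  then have "i < n" by simp
  have "(laplacian_block n c G *\<^sub>v x) $ i = 0"
    unfolding laplacian_block_def
      laplacian_mult_vec[OF simple_edges_intra_edges[OF assms(1)] assms(2) \<open>i < n\<close>]
  proof (intro sum.neutral ballI)
    fix j assume "j \<in> {..<n}"
    have "c i = c j" if "{i, j} \<in> intra_edges c G"
      using that unfolding intra_edges_def by blast
    then have "{i, j} \<notin> intra_edges c G \<or> x $ i = x $ j"
      using assms(3)[OF \<open>i < n\<close>, of j] \<open>j \<in> {..<n}\<close> by blast
    then show "(if {i, j} \<in> intra_edges c G then 1 else 0) * (x $ i - x $ j) = 0"
      by (elim disjE) simp_all
  qed
  then show "(laplacian_block n c G *\<^sub>v x) $ i = (0\<^sub>v n :: real vec) $ i"
    using \<open>i < n\<close> by simp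
qed (simp add: laplacian_block_def laplacian_def deg_mat_def adj_mat_def)

section \<open>Eigenvalues and eigenvectors of the Laplacian\<close>

lemma sorted_eigenbasis_orthonormal_family:
  assumes "sorted_eigenbasis n M lam u" "M \<in> carrier_mat n n"
  shows "orthonormal_family n n (\<lambda>k i. u k $ i)"
  unfolding orthonormal_family_def
proof (intro allI impI)
  fix j k assume "j < n" "k < n"
  then have "u k \<in> carrier_vec n" and "u j \<bullet> u k = (if j = k then 1 else 0)"
    using assms by (auto simp: sorted_eigenbasis_def eigenvector_def)
  then show "(\<Sum>i<n. u j $ i * u k $ i) = (if j = k then 1 else 0)"
    by (simp add: scalar_prod_def atLeast0LessThan)
qed

text \<open>At a unit eigenvector the quadratic form equals the eigenvalue.\<close>

lemma laplacian_eigenvalue_nonneg: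
  assumes "simple_edges n G" "sorted_eigenbasis n (laplacian n G) lam u" "k < n"
  shows "0 \<le> lam k"
proof -
  have ev: "eigenvector (laplacian n G) (u k) (lam k)" and norm: "u k \<bullet> u k = 1"
    using assms(2,3) by (auto simp: sorted_eigenbasis_def)
  have carrier: "u k \<in> carrier_vec n"
    using ev by (simp add: eigenvector_def laplacian_def deg_mat_def adj_mat_def)
  show ?thesis
    using laplacian_quadratic_form_nonneg[OF assms(1) carrier] ev norm carrier
    by (simp add: eigenvector_def)
qed

text \<open>The Laplacian is symmetric and can be moved to the eigenvector.\<close>

lemma eigenvector_scalar_prod_laplacian:
  assumes "eigenvector (laplacian n G) v l" "x \<in> carrier_vec n"
  shows "v \<bullet> (laplacian n G *\<^sub>v x) = l * (v \<bullet> x)"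
proof -
  have v: "v \<in> carrier_vec n" and ev: "laplacian n G *\<^sub>v v = l \<cdot>\<^sub>v v"
    using assms(1) by (auto simp: eigenvector_def laplacian_def deg_mat_def adj_mat_def)
  have "transpose_mat (laplacian n G) = laplacian n G"
  proof (rule eq_matI)
    fix i j assume "i < dim_row (laplacian n G)" "j < dim_col (laplacian n G)"
    moreover from this have "i < n" "j < n" using laplacian_carrier[of n G] by auto
    ultimately show "(transpose_mat (laplacian n G)) $$ (i, j) = laplacian n G $$ (i, j)"
      using carrier_matD[OF laplacian_carrier[of n G]]
      by (simp add: laplacian_symmetric[of j n i G])
  qed (use carrier_matD[OF laplacian_carrier[of n G]] in simp_all)
  then have "v \<bullet> (laplacian n G *\<^sub>v x) = (laplacian n G *\<^sub>v v) \<bullet> x"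
    using transpose_vec_mult_scalar[OF laplacian_carrier assms(2) v, of G] by simp
  also have "\<dots> = l * (v \<bullet> x)" using v assms(2) by (simp add: ev)
  finally show ?thesis .
qed

text \<open>A one-sided form of the Davis-Kahan theorem for cluster-wise constant vectors.\<close>

lemma cluster_constant_high_frequency_bound:
  fixes x :: "real vec" and u :: "nat \<Rightarrow> real vec"
  assumes simple: "simple_edges n G"
    and basis: "sorted_eigenbasis n (laplacian n G) lam u"
    and "K < n" "0 < \<delta>" "\<delta> \<le> lam K"
    and x: "x \<in> carrier_vec n" "l2_norm x \<le> 1"
    and const: "\<And>i j. i < n \<Longrightarrow> j < n \<Longrightarrow> c i = c j \<Longrightarrow> x $ i = x $ j"
  shows "(\<Sum>k=K..<n. (u k \<bullet> x)\<^sup>2) \<le> (spectral_norm (inter_part n c G) / \<delta>)\<^sup>2"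
proof -
  let ?E = "inter_part n c G"
  define y where "y = ?E *\<^sub>v x"
  have block: "laplacian_block n c G \<in> carrier_mat n n"
    by (simp add: laplacian_block_def)
  then have E: "?E \<in> carrier_mat n n" by (simp add: inter_part_def minus_carrier_mat)
  then have y: "y \<in> carrier_vec n" using x by (simp add: y_def)
  have "y = laplacian n G *\<^sub>v x - laplacian_block n c G *\<^sub>v x"
    unfolding y_def inter_part_def by (rule minus_mult_distrib_mat_vec[OF laplacian_carrier block x(1)])
  \<comment> \<open>The block part annihilates \<open>x\<close>, so \<open>E\<close> acts on
    \<open>x\<close> as the whole Laplacian does.\<close>
  then have y_eq: "y = laplacian n G *\<^sub>v x"
    using laplacian_block_cluster_constant[OF simple x(1) const] mult_mat_vec_carrier[OF laplacian_carrier x(1)]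
    by auto
  have ev: "eigenvector (laplacian n G) (u k) (lam k)" if "k < n" for k
    using basis that by (simp add: sorted_eigenbasis_def)
  have "\<delta>\<^sup>2 * (\<Sum>k=K..<n. (u k \<bullet> x)\<^sup>2) = (\<Sum>k=K..<n. \<delta>\<^sup>2 * (u k \<bullet> x)\<^sup>2)"
    by (rule sum_distrib_left)
  \<comment> \<open>Coefficient \<open>k\<close> of \<open>y\<close> is \<open>lam k\<close> times
    that of \<open>x\<close>, and \<open>lam k\<close> is at least \<open>lam K\<close>, hence at
    least \<open>\<delta>\<close>.\<close>
  also have "\<dots> \<le> (\<Sum>k=K..<n. (u k \<bullet> y)\<^sup>2)"
  proof (rule sum_mono)
    fix k assume k: "k \<in> {K..<n}"
    then have "lam K \<le> lam k" using basis by (simp add: sorted_eigenbasis_def)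
    then have "\<delta>\<^sup>2 \<le> (lam k)\<^sup>2" using \<open>0 < \<delta>\<close> \<open>\<delta> \<le> lam K\<close> by (intro power_mono) auto
    moreover have "u k \<bullet> y = lam k * (u k \<bullet> x)"
      unfolding y_eq using ev k x by (intro eigenvector_scalar_prod_laplacian) auto
    ultimately show "\<delta>\<^sup>2 * (u k \<bullet> x)\<^sup>2 \<le> (u k \<bullet> y)\<^sup>2"
      by (simp add: power_mult_distrib mult_right_mono)
  qed
  also have "\<dots> \<le> (\<Sum>k<n. (u k \<bullet> y)\<^sup>2)" by (intro sum_mono2) auto
  also have "\<dots> = (l2_norm y)\<^sup>2"
    using orthonormal_basis_parseval[OF sorted_eigenbasis_orthonormal_family[OF basis laplacian_carrier],
        of "\<lambda>i. y $ i"] y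
    by (simp add: l2_norm_power2 scalar_prod_def atLeast0LessThan)
  also have "\<dots> \<le> (spectral_norm ?E)\<^sup>2"
    unfolding y_def using x E
    by (intro power_mono l2_norm_mult_vec_le_spectral_norm l2_norm_nonneg) auto
  finally show ?thesis
    using \<open>0 < \<delta>\<close> by (simp add: power_divide pos_le_divide_eq mult.commute)
qed

section \<open>Coresets\<close>

lemma best_candidates_nonempty:
  assumes "finite C" "C \<noteq> {}"
  shows "best_candidates L b C \<noteq> {}"
  using ex_is_arg_min_if_finite[OF assms, of "\<lambda>j. \<bar>col L j \<bullet> b\<bar>"]
  by (auto simp: best_candidates_def is_arg_min_linorder)

text \<open>The bound \<open>s t \<le> n\<close> keeps the family of candidate sets nonempty, and
  the set of minimisers is nonempty as well, so the support of each \<open>pmf_of_set\<close> is the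
  set itself.\<close>

lemma ggcs_state_subset:
  assumes "\<And>t. t < T \<Longrightarrow> s t \<le> n" "z \<in> set_pmf (ggcs_state n L s T)"
  shows "snd z \<subseteq> {..<n}"
  using assms
proof (induction T arbitrary: z)
  case (Suc T)
  obtain b X where prev: "(b, X) \<in> set_pmf (ggcs_state n L s T)"
    and step: "z \<in> set_pmf (ggcs_step n L (s T) (b, X))"
    using Suc.prems(2) by auto
  have X: "X \<subseteq> {..<n}" using Suc.IH[OF _ prev] Suc.prems(1) by simp
  let ?\<C> = "{C. C \<subseteq> {..<n} \<and> card C = s T}"
  have "?\<C> \<noteq> {}"
    using obtain_subset_with_card_n[of "s T" "{..<n}"] Suc.prems(1)[of T] by auto
  moreover have "finite ?\<C>" by simp
  ultimately obtain C where C: "C \<subseteq> {..<n}"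
    and z: "z \<in> set_pmf (if C \<subseteq> X then return_pmf (b, X)
      else map_pmf (\<lambda>i. (b - col L i, insert i X)) (pmf_of_set (best_candidates L b (C - X))))"
    using step unfolding ggcs_step_def by (auto simp: set_pmf_of_set)
  show ?case
  proof (cases "C \<subseteq> X")
    case True
    then show ?thesis using z X by simp
  next
    case False
    have fin: "finite (C - X)" using C finite_subset by blast
    have "best_candidates L b (C - X) \<noteq> {}"
      using False fin by (intro best_candidates_nonempty) auto
    moreover have sub: "best_candidates L b (C - X) \<subseteq> C - X"
      by (auto simp: best_candidates_def)
    ultimately obtain i where "i \<in> C" "z = (b - col L i, insert i X)"
      using z False finite_subset[OF sub fin] by (auto simp: set_pmf_of_set)
    then show ?thesis using C X by auto
  qed
qed simp

lemma ggcs_subset: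
  assumes "\<And>t. t < T \<Longrightarrow> s t \<le> n" "S \<in> set_pmf (ggcs n L s T)"
  shows "S \<subseteq> {..<n}"
  using assms ggcs_state_subset[of T s n _ L] by (auto simp: ggcs_def)

section \<open>Cluster averages\<close>

text \<open>Cluster \<open>a\<close> is nonempty in all uses; otherwise \<open>cluster_indicator\<close> vanishes and
  \<open>cluster_mean\<close> is \<open>0\<close> by division by zero.\<close>

definition cluster_indicator :: "nat \<Rightarrow> (nat \<Rightarrow> nat) \<Rightarrow> nat \<Rightarrow> nat \<Rightarrow> real" where
  "cluster_indicator n c a i = (if c i = a then 1 / sqrt (real (card (cluster n c a))) else 0)"

definition cluster_mean :: "nat \<Rightarrow> (nat \<Rightarrow> nat) \<Rightarrow> (nat \<Rightarrow> real) \<Rightarrow> nat \<Rightarrow> real" where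
  "cluster_mean n c x a = (\<Sum>i\<in>cluster n c a. x i) / real (card (cluster n c a))"

lemma finite_cluster [simp]: "finite (cluster n c a)"
  by (simp add: cluster_def)

lemma card_cluster_pos:
  assumes "c ` {..<n} = {..<K}" "a < K"
  shows "0 < card (cluster n c a)"
proof -
  from assms obtain i where "i < n" "c i = a" by (metis imageE lessThan_iff)
  then show ?thesis by (auto simp: card_gt_0_iff cluster_def)
qed

lemma sum_cluster_indicator:
  "(\<Sum>i<n. cluster_indicator n c a i * x i)
    = (\<Sum>i\<in>cluster n c a. x i) / sqrt (real (card (cluster n c a)))"
proof -
  have "(\<Sum>i<n. cluster_indicator n c a i * x i)
      = (\<Sum>i\<in>cluster n c a. cluster_indicator n c a i * x i)"
    by (rule sum.mono_neutral_right) (auto simp: cluster_def cluster_indicator_def)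
  also have "\<dots> = (\<Sum>i\<in>cluster n c a. x i / sqrt (real (card (cluster n c a))))"
    by (intro sum.cong) (auto simp: cluster_def cluster_indicator_def)
  finally show ?thesis by (simp add: sum_divide_distrib)
qed

lemma orthonormal_family_cluster_indicator:
  assumes "c ` {..<n} = {..<K}"
  shows "orthonormal_family n K (cluster_indicator n c)"
  unfolding orthonormal_family_def
proof (intro allI impI)
  fix a b assume "a < K" "b < K"
  have pos: "0 < real (card (cluster n c a))" using card_cluster_pos[OF assms \<open>a < K\<close>] by simp
  have "(\<Sum>i\<in>cluster n c a. cluster_indicator n c b i)
      = (\<Sum>i\<in>cluster n c a. if a = b then 1 / sqrt (real (card (cluster n c a))) else 0)"
    by (intro sum.cong) (auto simp: cluster_def cluster_indicator_def)
  then show "(\<Sum>i<n. cluster_indicator n c a i * cluster_indicator n c b i) = (if a = b then 1 else 0)"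
    unfolding sum_cluster_indicator using pos by auto
qed

text \<open>Only the cluster of \<open>i\<close> contributes; the two square roots, from coefficient
  and indicator, multiply to its size.\<close>

lemma cluster_projection_eq_mean:
  assumes "c ` {..<n} = {..<K}" "i < n"
  shows "(\<Sum>a<K. (\<Sum>j<n. cluster_indicator n c a j * x j) * cluster_indicator n c a i)
    = cluster_mean n c x (c i)"
proof -
  have "c i < K" using assms by auto
  then show ?thesis
    unfolding sum_cluster_indicator
    by (simp add: cluster_indicator_def cluster_mean_def if_distrib[of "\<lambda>t. _ * t"] cong: if_cong)
qed

text \<open>The mean is the coefficient divided by the square root of the cluster size, which is at
  least 1 for a nonempty cluster.\<close>

lemma abs_cluster_mean_le: "\<bar>cluster_mean n c x a\<bar> \<le> \<bar>\<Sum>j<n. cluster_indicator n c a j * x j\<bar>"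
proof (cases "card (cluster n c a) = 0")
  case True
  then show ?thesis by (simp add: cluster_mean_def)
next
  case False
  define m where "m = real (card (cluster n c a))"
  have "1 \<le> m" using False by (simp add: m_def del: card_0_eq card_eq_0_iff)
  then have "sqrt m \<le> m" by (simp add: real_le_lsqrt power2_eq_square)
  with \<open>1 \<le> m\<close> show ?thesis
    unfolding sum_cluster_indicator cluster_mean_def m_def[symmetric]
    by (simp add: abs_divide divide_left_mono)
qed

lemma sum_by_cluster:
  assumes "c ` {..<n} = {..<K}" "A \<subseteq> {..<n}"
  shows "(\<Sum>i\<in>A. g (c i)) = (\<Sum>a<K. real (card (A \<inter> cluster n c a)) * g a)"
proof -
  have fin: "finite A" using assms(2) finite_subset by blast
  have "(\<Sum>i\<in>A. g (c i)) = (\<Sum>a<K. \<Sum>i\<in>{i\<in>A. c i = a}. g (c i))"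
    using assms by (intro sum.group[symmetric] fin) auto
  also have "\<dots> = (\<Sum>a<K. real (card (A \<inter> cluster n c a)) * g a)"
  proof (intro sum.cong refl)
    fix a
    have "{i\<in>A. c i = a} = A \<inter> cluster n c a" using assms(2) by (auto simp: cluster_def)
    then show "(\<Sum>i\<in>{i\<in>A. c i = a}. g (c i)) = real (card (A \<inter> cluster n c a)) * g a"
      by (simp add: cluster_def)
  qed
  finally show ?thesis .
qed

lemma sum_eq_sum_cluster_mean:
  assumes "c ` {..<n} = {..<K}"
  shows "(\<Sum>i<n. x i) = (\<Sum>a<K. real (card (cluster n c a)) * cluster_mean n c x a)"
proof -
  have "(\<Sum>i<n. x i) = (\<Sum>a<K. \<Sum>i\<in>{i\<in>{..<n}. c i = a}. x i)"
    using assms by (intro sum.group[symmetric]) auto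
  also have "\<dots> = (\<Sum>a<K. real (card (cluster n c a)) * cluster_mean n c x a)"
  proof (intro sum.cong refl)
    fix a assume "a \<in> {..<K}"
    then have "0 < card (cluster n c a)" using card_cluster_pos[OF assms] by simp
    moreover have "{i \<in> {..<n}. c i = a} = cluster n c a" by (auto simp: cluster_def)
    ultimately show "(\<Sum>i\<in>{i\<in>{..<n}. c i = a}. x i) = real (card (cluster n c a)) * cluster_mean n c x a"
      by (simp add: cluster_mean_def del: card_gt_0_iff)
  qed
  finally show ?thesis .
qed

lemma sum_abs_cluster_mean_le:
  assumes "c ` {..<n} = {..<K}"
  shows "(\<Sum>a<K. \<bar>cluster_mean n c x a\<bar>) \<le> sqrt (real K) * L2_set x {..<n}"
proof -
  let ?h = "\<lambda>a. \<Sum>j<n. cluster_indicator n c a j * x j"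
  have "(\<Sum>a<K. \<bar>cluster_mean n c x a\<bar>) \<le> (\<Sum>a<K. \<bar>1\<bar> * \<bar>?h a\<bar>)"
    by (intro sum_mono) (simp add: abs_cluster_mean_le)
  also have "\<dots> \<le> L2_set (\<lambda>_. 1) {..<K} * L2_set ?h {..<K}"
    by (rule L2_set_mult_ineq)
  also have "\<dots> \<le> sqrt (real K) * L2_set x {..<n}"
  proof (intro mult_mono)
    \<comment> \<open>Bessel's inequality, read off from the nonnegative residual.\<close>
    have "0 \<le> (\<Sum>i<n. (x i - (\<Sum>a<K. ?h a * cluster_indicator n c a i))\<^sup>2)"
      by (intro sum_nonneg) simp
    then show "L2_set ?h {..<K} \<le> L2_set x {..<n}"
      unfolding orthonormal_family_residual[OF orthonormal_family_cluster_indicator[OF assms]]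
      by (simp add: L2_set_def)
  qed (simp_all add: L2_set_def sum_nonneg)
  finally show ?thesis .
qed

section \<open>Sampling error of the coreset mean\<close>

lemma coreset_mean_deviation:
  assumes c: "c ` {..<n} = {..<K}" and S: "S \<subseteq> {..<n}" "card S = T"
    and counts: "\<And>a. a < K \<Longrightarrow>
      real (card (S \<inter> cluster n c a)) / real T = real (card (cluster n c a)) / real n + e a"
    and e: "\<And>a. a < K \<Longrightarrow> \<bar>e a\<bar> \<le> \<epsilon>" and "0 \<le> \<epsilon>"
  shows "\<bar>(1 / real T) * (\<Sum>i\<in>S. x i) - (1 / real n) * (\<Sum>i<n. x i)\<bar>
    \<le> \<epsilon> * (sqrt (real K) * L2_set x {..<n})
      + L2_set (\<lambda>i. x i - cluster_mean n c x (c i)) {..<n} / sqrt (real T)"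
proof -
  let ?g = "cluster_mean n c x"
  let ?r = "\<lambda>i. x i - ?g (c i)"
  have fin: "finite S" using S(1) finite_subset by blast
  have "(1 / real T) * (\<Sum>i\<in>S. ?g (c i)) = (\<Sum>a<K. real (card (S \<inter> cluster n c a)) / real T * ?g a)"
    unfolding sum_by_cluster[OF c S(1)] by (simp add: sum_distrib_left)
  \<comment> \<open>The proportional shares reassemble to the global mean; only the deviations
    \<open>e a\<close> survive.\<close>
  also have "\<dots> = (\<Sum>a<K. (real (card (cluster n c a)) / real n + e a) * ?g a)"
    using counts by (intro sum.cong) auto
  also have "\<dots> = (1 / real n) * (\<Sum>i<n. x i) + (\<Sum>a<K. e a * ?g a)"
    unfolding sum_eq_sum_cluster_mean[OF c]
    by (simp add: distrib_right sum.distrib sum_distrib_left)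
  finally have decomp: "(1 / real T) * (\<Sum>i\<in>S. x i) - (1 / real n) * (\<Sum>i<n. x i)
      = (\<Sum>a<K. e a * ?g a) + (1 / real T) * (\<Sum>i\<in>S. ?r i)"
    by (simp add: sum_subtractf right_diff_distrib)
  have "\<bar>\<Sum>a<K. e a * ?g a\<bar> \<le> (\<Sum>a<K. \<epsilon> * \<bar>?g a\<bar>)"
    using e by (intro order_trans[OF sum_abs] sum_mono) (auto simp: abs_mult intro: mult_right_mono)
  also have "\<dots> \<le> \<epsilon> * (sqrt (real K) * L2_set x {..<n})"
    unfolding sum_distrib_left[symmetric]
    using sum_abs_cluster_mean_le[OF c] \<open>0 \<le> \<epsilon>\<close> by (intro mult_left_mono) auto
  finally have first: "\<bar>\<Sum>a<K. e a * ?g a\<bar> \<le> \<epsilon> * (sqrt (real K) * L2_set x {..<n})" .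
  have "\<bar>\<Sum>i\<in>S. ?r i\<bar> \<le> (\<Sum>i\<in>S. \<bar>1\<bar> * \<bar>?r i\<bar>)" by (rule order_trans[OF sum_abs]) simp
  also have "\<dots> \<le> L2_set (\<lambda>_. 1) S * L2_set ?r S" by (rule L2_set_mult_ineq)
  \<comment> \<open>The constant 1 has norm \<open>sqrt T\<close> on \<open>S\<close>; the residual
    is enlarged from \<open>S\<close> to all nodes.\<close>
  also have "\<dots> \<le> sqrt (real T) * L2_set ?r {..<n}"
    using S sum_mono2[OF finite_lessThan S(1), of "\<lambda>i. (?r i)\<^sup>2"]
    by (intro mult_mono) (auto simp: L2_set_def intro: sum_nonneg)
  finally have "\<bar>(1 / real T) * (\<Sum>i\<in>S. ?r i)\<bar> \<le> (1 / real T) * (sqrt (real T) * L2_set ?r {..<n})"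
    unfolding abs_mult by (simp add: divide_right_mono)
  also have "\<dots> = L2_set ?r {..<n} / sqrt (real T)"
    \<comment> \<open>For \<open>T = 0\<close> both sides are zero by division by zero.\<close>
    by (cases "T = 0") (simp_all add: field_simps)
  finally show ?thesis
    unfolding decomp using first by linarith
qed

text \<open>The residual bound is applied with the cluster indicators as \<open>w\<close>. Each of
  the \<open>K\<close> indicators has high-frequency energy at most the square of
  \<open>?\<rho>\<close>, whence the factor \<open>sqrt K\<close>.\<close>

lemma bandlimited_cluster_mean_error:
  fixes f :: "real vec" and u :: "nat \<Rightarrow> real vec"
  assumes simple: "simple_edges n G"
    and basis: "sorted_eigenbasis n (laplacian n G) lam u"
    and c: "c ` {..<n} = {..<K}" and "K < n" "0 < \<delta>" "\<delta> \<le> lam K"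
    and f: "f \<in> carrier_vec n" "\<And>k. K \<le> k \<Longrightarrow> k < n \<Longrightarrow> u k \<bullet> f = 0"
  shows "L2_set (\<lambda>i. f $ i - cluster_mean n c (($) f) (c i)) {..<n}
    \<le> sqrt (real K) * l2_norm f * (spectral_norm (inter_part n c G) / \<delta>)"
proof -
  let ?w = "cluster_indicator n c"
  let ?\<rho> = "spectral_norm (inter_part n c G) / \<delta>"
  note U = sorted_eigenbasis_orthonormal_family[OF basis laplacian_carrier]
  note w = orthonormal_family_cluster_indicator[OF c]
  \<comment> \<open>Evaluating at the zero vector shows that the supremum defining the spectral norm
    is nonnegative.\<close>
  have "l2_norm (inter_part n c G *\<^sub>v 0\<^sub>v n) \<le> spectral_norm (inter_part n c G)"
    by (intro l2_norm_mult_vec_le_spectral_norm)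
      (auto simp: inter_part_def laplacian_block_def laplacian_def deg_mat_def adj_mat_def
        l2_norm_def L2_set_def)
  then have rho: "0 \<le> ?\<rho>"
    using l2_norm_nonneg order_trans \<open>0 < \<delta>\<close> by (intro divide_nonneg_pos) blast+
  have indicator: "(\<Sum>k=K..<n. (\<Sum>i<n. u k $ i * ?w a i)\<^sup>2) \<le> ?\<rho>\<^sup>2" if "a < K" for a
  proof -
    let ?x = "Matrix.vec n (?w a)"
    have "(l2_norm ?x)\<^sup>2 = 1"
      using w that unfolding l2_norm_power2 orthonormal_family_def by (simp add: power2_eq_square)
    then have "l2_norm ?x \<le> 1" using l2_norm_nonneg[of ?x] by (simp add: power2_eq_1_iff)
    then have "(\<Sum>k=K..<n. (u k \<bullet> ?x)\<^sup>2) \<le> ?\<rho>\<^sup>2"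
      by (intro cluster_constant_high_frequency_bound[OF simple basis \<open>K < n\<close> \<open>0 < \<delta>\<close> \<open>\<delta> \<le> lam K\<close>])
        (auto simp: cluster_indicator_def)
    then show ?thesis by (simp add: scalar_prod_def atLeast0LessThan)
  qed
  have "(\<Sum>i<n. (f $ i - cluster_mean n c (($) f) (c i))\<^sup>2)
      = (\<Sum>i<n. (f $ i - (\<Sum>a<K. (\<Sum>j<n. ?w a j * f $ j) * ?w a i))\<^sup>2)"
    using cluster_projection_eq_mean[OF c] by (intro sum.cong) auto
  also have "\<dots> \<le> (\<Sum>i<n. (f $ i)\<^sup>2) * (\<Sum>a<K. \<Sum>k=K..<n. (\<Sum>i<n. u k $ i * ?w a i)\<^sup>2)"
    using f \<open>K < n\<close>
    by (intro bandlimited_residual_bound[OF U w]) (auto simp: scalar_prod_def atLeast0LessThan)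
  also have "\<dots> \<le> (\<Sum>i<n. (f $ i)\<^sup>2) * (\<Sum>a<K. ?\<rho>\<^sup>2)"
    using indicator by (intro mult_left_mono sum_mono sum_nonneg) auto
  also have "\<dots> = (sqrt (real K) * l2_norm f * ?\<rho>)\<^sup>2"
    using f(1) by (simp add: power_mult_distrib power_divide l2_norm_power2)
  finally show ?thesis
    unfolding L2_set_def using rho l2_norm_nonneg[of f]
    by (intro real_le_lsqrt mult_nonneg_nonneg) (auto intro: sum_nonneg)
qed

theorem theorem3:
  fixes K :: "nat \<Rightarrow> nat" and c :: "nat \<Rightarrow> nat \<Rightarrow> nat"
    and p :: "nat \<Rightarrow> nat \<Rightarrow> real" and q :: "nat \<Rightarrow> nat \<Rightarrow> nat \<Rightarrow> real"
    and \<omega>_seq :: "nat \<Rightarrow> real" and N n T :: nat and G :: "nat set set"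
    and lam :: "nat \<Rightarrow> real" and u :: "nat \<Rightarrow> real vec" and \<omega> :: real and f :: "real vec"
    and s :: "nat \<Rightarrow> nat" and S :: "nat set" and eps :: "nat \<Rightarrow> real" and \<epsilon> :: real
  assumes params: "\<And>n. n \<ge> N \<Longrightarrow> sbm_params n (K n) (c n) (p n) (q n)"
    and sparse_inter:
      "(\<lambda>n. Max (insert 0 {q n a b | a b. a < K n \<and> b < K n \<and> a \<noteq> b}))
         \<in> o(\<lambda>n. Min {p n a | a. a < K n})"
    and intra_degree:
      "\<And>n a. n \<ge> N \<Longrightarrow> a < K n \<Longrightarrow> real (card (cluster n (c n) a)) * p n a = \<omega>_seq n"
    and "filterlim \<omega>_seq at_top sequentially"
    and "n \<ge> N" and "K n < n"
    and graph: "G \<in> set_pmf (sbm n (c n) (p n) (q n))"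
    and eigenbasis: "sorted_eigenbasis n (laplacian n G) lam u"
    and bandwidth: "lam (K n - 1) < \<omega>" "\<omega> < lam (K n)"
    and signal: "f \<in> paley_wiener n lam u \<omega>"
    and "T \<ge> 1" and "\<And>t. t < T \<Longrightarrow> 1 \<le> s t \<and> s t \<le> n"
    and coreset: "S \<in> set_pmf (ggcs n (laplacian n G) s T)" "card S = T"
    and counts: "\<And>a. a < K n \<Longrightarrow>
        real (card (S \<inter> cluster n (c n) a)) / real T
          = real (card (cluster n (c n) a)) / real n + eps a"
    and eps: "\<And>a. a < K n \<Longrightarrow> \<bar>eps a\<bar> \<le> \<epsilon>"
  shows "\<bar>(1 / real T) * (\<Sum>i\<in>S. f $ i) - (1 / real n) * (\<Sum>i<n. f $ i)\<bar>
           \<le> sqrt (real (K n)) * l2_norm f *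
             (\<epsilon> * sqrt (2 * real (K n))
              + 4 * spectral_norm (inter_part n (c n) G)
                / ((lam (K n) - lam (K n - 1)) * sqrt (real T)))"
proof -
  define \<Delta> where "\<Delta> = lam (K n) - lam (K n - 1)"
  let ?e = "spectral_norm (inter_part n (c n) G)"
  have c: "c n ` {..<n} = {..<K n}" and "1 \<le> K n"
    using params[OF \<open>n \<ge> N\<close>] by (auto simp: sbm_params_def)
  have simple: "simple_edges n G" using graph by (rule set_pmf_sbm)
  have f: "f \<in> carrier_vec n" using signal by (simp add: paley_wiener_def)
  have high: "u k \<bullet> f = 0" if "K n \<le> k" "k < n" for k
  proof -
    have "lam (K n) \<le> lam k" using eigenbasis that by (simp add: sorted_eigenbasis_def)
    then show ?thesis
      using signal bandwidth that by (simp add: paley_wiener_def fourier_coeff_def)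
  qed
  have "0 < \<Delta>" using bandwidth by (simp add: \<Delta>_def)
  \<comment> \<open>This amounts to \<open>lam (K n - 1)\<close> being nonnegative.\<close>
  have "\<Delta> \<le> lam (K n)"
    using laplacian_eigenvalue_nonneg[OF simple eigenbasis, of "K n - 1"] \<open>K n < n\<close>
    by (simp add: \<Delta>_def)
  have "0 \<le> \<epsilon>" using eps[of 0] \<open>1 \<le> K n\<close> by linarith
  \<comment> \<open>\<open>assms(13)\<close> is the bound on the candidate sizes
    \<open>s t\<close>.\<close>
  have S: "S \<subseteq> {..<n}" using coreset(1) assms(13) by (intro ggcs_subset[of T s n S]) auto
  define F where "F = sqrt (real (K n)) * l2_norm f"
  have "0 \<le> F" by (simp add: F_def l2_norm_nonneg)
  let ?r = "L2_set (\<lambda>i. f $ i - cluster_mean n (c n) (($) f) (c n i)) {..<n}"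
  have r: "?r \<le> F * (?e / \<Delta>)"
    unfolding F_def
    by (rule bandlimited_cluster_mean_error[OF simple eigenbasis c \<open>K n < n\<close> \<open>0 < \<Delta>\<close>
          \<open>\<Delta> \<le> lam (K n)\<close> f high])
  moreover have "0 \<le> ?r" by simp
  \<comment> \<open>The argument yields constant 1; it may be raised to 4 because
    \<open>0 \<le> ?r\<close> makes the bound nonnegative.\<close>
  ultimately have "?r \<le> 4 * (F * (?e / \<Delta>))" by linarith
  then have "?r / sqrt (real T) \<le> 4 * (F * (?e / \<Delta>)) / sqrt (real T)"
    by (rule divide_right_mono) simp
  \<comment> \<open>The factor \<open>sqrt (2 * K)\<close> is at least 1, so inserting it only
    weakens the bound.\<close>
  moreover have "\<epsilon> * F \<le> F * (\<epsilon> * sqrt (2 * real (K n)))"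
  proof -
    have "1 \<le> sqrt (2 * real (K n))" using \<open>1 \<le> K n\<close> by simp
    then show ?thesis
      using mult_left_mono[of 1 "sqrt (2 * real (K n))" "\<epsilon> * F"] \<open>0 \<le> \<epsilon>\<close> \<open>0 \<le> F\<close>
      by (simp add: mult_ac)
  qed
  moreover have "\<bar>(1 / real T) * (\<Sum>i\<in>S. f $ i) - (1 / real n) * (\<Sum>i<n. f $ i)\<bar>
      \<le> \<epsilon> * F + ?r / sqrt (real T)"
    using coreset_mean_deviation[OF c S coreset(2) counts eps \<open>0 \<le> \<epsilon>\<close>, of "($) f"] f
    by (simp add: F_def l2_norm_def)
  ultimately have "\<bar>(1 / real T) * (\<Sum>i\<in>S. f $ i) - (1 / real n) * (\<Sum>i<n. f $ i)\<bar>
      \<le> F * (\<epsilon> * sqrt (2 * real (K n))) + 4 * (F * (?e / \<Delta>)) / sqrt (real T)"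
    by linarith
  also have "\<dots> = F * (\<epsilon> * sqrt (2 * real (K n)) + 4 * ?e / (\<Delta> * sqrt (real T)))"
    by (simp add: distrib_left)
  finally show ?thesis by (simp add: F_def \<Delta>_def)
qed

end
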